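(* Let $G$ be a simple connected graph with $p \geq 2$ vertices and diameter $d$. Let $L_0$ be any nonempty set of vertices of $G$ (the vertex set of an induced subgraph of $G$), and let $k = \max\{d(u,v) : u,v \in L_0\}$, where $d$ denotes the distance in $G$. Define $L_1 = N(L_0)\setminus L_0$ and recursively $L_{i+1} = N(L_i)\setminus (L_0\cup \cdots \cup L_i)$, where $N(S)$ is the set of vertices adjacent to some vertex of $S$; let $h$ be the largest index with $L_h \neq \emptyset$. For a vertex $v$ let $d(v,L_0)=\min\{d(v,w): w\in L_0\}$. Let $\delta = 0$ if $|L_0|\geq 2$ and $\delta = 1$ if $|L_0| = 1$. Then $$\mathrm{rn}(G) = (p-1)(d-k+1)+\delta-2\sum_{i=0}^{h}|L_i|\, i$$ holds if and only if there exist a radio labeling $\varphi$ of $G$ and an ordering $x_0,x_1,\dots,x_{p-1}$ of $V(G)$ with $0=\varphi(x_0)<\varphi(x_1)<\cdots<\varphi(x_{p-1}) = \mathrm{span}(\varphi) = \mathrm{rn}(G)$ such that all of the following hold for $0\leq i\leq p-2$: (a) $d(x_i,x_{i+1}) = d(x_i,L_0)+d(x_{i+1},L_0)+k$; (b) $x_0,x_{p-1}\in L_0$ if $|L_0|\geq 2$, and $x_0\in L_0$, $x_{p-1}\in L_1$ if $|L_0|=1$; (c) $\varphi(x_0)=0$ and $\varphi(x_{i+1}) = \varphi(x_i)+d+1-d(x_i,L_0)-d(x_{i+1},L_0)-k$.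
   Context: A radio labeling of a connected graph $G$ is a map $\varphi: V(G)\to\{0,1,2,\dots\}$ such that $d(u,v)+|\varphi(u)-\varphi(v)| \geq \mathrm{diam}(G)+1$ for every pair of distinct vertices $u,v$, where $d(u,v)$ is the graph distance and $\mathrm{diam}(G)$ the diameter. The span of $\varphi$ is $\max\{|\varphi(u)-\varphi(v)| : u,v\in V(G)\}$, and the radio number $\mathrm{rn}(G)$ is the minimum span over all radio labelings of $G$. Note that $L_i$ is exactly the set of vertices at distance $i$ from $L_0$. *)

theory Defs
  imports "Graph_Theory.Graph_Theory"
begin

text \<open>
  A simple graph is a symmetric, loop-free digraph without parallel arcs (locale \<^locale>\<open>graph\<close>):
  each undirected edge is a pair of opposite arcs, so walks and adjacency agree with
  the undirected ones.
\<close>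

text \<open>
  Natural-number valued distance. It coincides with the library's unit-weight
  shortest-path distance \<open>\<mu> (\<lambda>_. 1)\<close> whenever \<open>v\<close> is reachable from \<open>u\<close> (lemma below);
  in a connected graph this is always so.
\<close>
definition gdist :: "('a, 'b) pre_digraph \<Rightarrow> 'a \<Rightarrow> 'a \<Rightarrow> nat" where
  "gdist G u v = (LEAST n. \<exists>p. pre_digraph.awalk G u p v \<and> length p = n)"

lemma (in wf_digraph) mu_unit_eq_gdist:
  assumes "u \<rightarrow>\<^sup>* v"
  shows "\<mu> (\<lambda>_. 1) u v = ereal (real (gdist G u v))"
proof -
  have cost: "awalk_cost (\<lambda>_. 1) p = real (length p)" for p
    by (simp add: awalk_cost_def sum_list_triv)
  have "\<exists>n p. awalk u p v \<and> length p = n"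
    using assms by (auto simp: reachable_awalk)
  then have "\<exists>p. awalk u p v \<and> length p = gdist G u v"
    unfolding gdist_def by (rule LeastI_ex)
  then obtain p where p: "awalk u p v" "length p = gdist G u v" by blast
  show ?thesis
  proof (rule antisym)
    show "\<mu> (\<lambda>_. 1) u v \<le> ereal (real (gdist G u v))"
      using min_cost_le_walk_cost[OF p(1), of "\<lambda>_. 1"] p(2) by (simp add: cost)
    have "gdist G u v \<le> length q" if "awalk u q v" for q
      unfolding gdist_def using that by (blast intro: Least_le)
    then show "ereal (real (gdist G u v)) \<le> \<mu> (\<lambda>_. 1) u v"
      unfolding \<mu>_def by (intro INF_greatest) (simp add: cost)
  qed
qed

definition max_dist :: "('a, 'b) pre_digraph \<Rightarrow> 'a set \<Rightarrow> nat" where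
  "max_dist G S = Max {gdist G u v | u v. u \<in> S \<and> v \<in> S}"

definition diam :: "('a, 'b) pre_digraph \<Rightarrow> nat" where
  "diam G = max_dist G (verts G)"

definition dist_to_set :: "('a, 'b) pre_digraph \<Rightarrow> 'a \<Rightarrow> 'a set \<Rightarrow> nat" where
  "dist_to_set G v S = Min {gdist G v w | w. w \<in> S}"

definition nbhd :: "('a, 'b) pre_digraph \<Rightarrow> 'a set \<Rightarrow> 'a set" where
  "nbhd G S = {v \<in> verts G. \<exists>u\<in>S. u \<rightarrow>\<^bsub>G\<^esub> v}"

fun layer :: "('a, 'b) pre_digraph \<Rightarrow> 'a set \<Rightarrow> nat \<Rightarrow> 'a set" where
  "layer G L0 0 = L0"
| "layer G L0 (Suc i) = nbhd G (layer G L0 i) - (\<Union>j\<in>{0..i}. layer G L0 j)"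

text \<open>Only the values of a labeling on \<open>verts G\<close> matter.\<close>
definition radio_labeling :: "('a, 'b) pre_digraph \<Rightarrow> ('a \<Rightarrow> nat) \<Rightarrow> bool" where
  "radio_labeling G \<phi> \<longleftrightarrow>
     (\<forall>u\<in>verts G. \<forall>v\<in>verts G. u \<noteq> v \<longrightarrow>
        int (gdist G u v) + \<bar>int (\<phi> u) - int (\<phi> v)\<bar> \<ge> int (diam G) + 1)"

definition label_span :: "('a, 'b) pre_digraph \<Rightarrow> ('a \<Rightarrow> nat) \<Rightarrow> nat" where
  "label_span G \<phi> = Max {nat \<bar>int (\<phi> u) - int (\<phi> v)\<bar> | u v. u \<in> verts G \<and> v \<in> verts G}"

definition radio_number :: "('a, 'b) pre_digraph \<Rightarrow> nat" where
  "radio_number G = (LEAST s. \<exists>\<phi>. radio_labeling G \<phi> \<and> label_span G \<phi> = s)"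

end

theory Submission
  imports Defs
begin

text \<open>
  Write \<open>l v\<close> for the distance from \<open>v\<close> to \<open>L0\<close> and list the vertices by increasing label as
  \<open>x 0, \<dots>, x (p - 1)\<close>. The radio condition and the triangle inequality through \<open>L0\<close> give
  \<open>\<phi> (x (i + 1)) - \<phi> (x i) \<ge> d + 1 - l (x i) - l (x (i + 1)) - k\<close>. Summing over \<open>i\<close>, the span is
  the claimed value plus \<open>l (x 0) + l (x (p - 1)) - \<delta>\<close> plus the slacks of these inequalities, all of
  which are nonnegative. So equality holds iff they all vanish, which is (a)--(c); if
  \<open>|L0| = 1\<close> the vanishing of the end term fixes the two ends only up to reversing the labeling.
\<close>

section \<open>Orderings by increasing label, and relabelings\<close>

definition optimal_ordering :: "('a, 'b) pre_digraph \<Rightarrow> ('a \<Rightarrow> nat) \<Rightarrow> (nat \<Rightarrow> 'a) \<Rightarrow> bool" where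
  "optimal_ordering G \<phi> x \<longleftrightarrow>
     radio_labeling G \<phi> \<and> bij_betw x {0..card (verts G) - 1} (verts G) \<and> \<phi> (x 0) = 0 \<and>
     (\<forall>i<card (verts G) - 1. \<phi> (x i) < \<phi> (x (Suc i))) \<and>
     \<phi> (x (card (verts G) - 1)) = label_span G \<phi> \<and> label_span G \<phi> = radio_number G"

text \<open>The left side telescopes. Each inner \<open>l i\<close> is subtracted in two consecutive
  steps, each end value in only one, so the doubled sum overcounts the two ends once each.\<close>

lemma sum_slack:
  fixes f l :: "nat \<Rightarrow> int"
  shows "f m - f 0 = int m * c - 2 * (\<Sum>i=0..m. l i) + l 0 + l m
     + (\<Sum>i<m. f (Suc i) - f i - (c - l i - l (Suc i)))"
  by (induction m) (simp_all add: algebra_simps)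

lemma strict_steps_mono:
  fixes f :: "nat \<Rightarrow> nat"
  assumes "\<forall>i<m. f i < f (Suc i)" "i \<le> j" "j \<le> m"
  shows "f i \<le> f j"
  using assms(2,3)
proof (induction j rule: dec_induct)
  case (step j)
  then have "f i \<le> f j" "f j < f (Suc j)"
    using assms(1) by auto
  then show ?case by simp
qed simp

text \<open>The finite set of values is enumerated increasingly, and the enumeration is pulled back
  along the inverse of \<open>f\<close>; injectivity makes the two cardinalities agree.\<close>

lemma ordering_by_labels:
  fixes f :: "'a \<Rightarrow> nat"
  assumes "finite A" "inj_on f A"
  obtains x where "bij_betw x {0..<card A} A"
    and "\<And>i j. i < j \<Longrightarrow> j < card A \<Longrightarrow> f (x i) < f (x j)"
proof -
  have fin: "finite (f ` A)" and card: "card (f ` A) = card A"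
    using assms by (auto simp: card_image)
  obtain g where g: "bij_betw g {..<card A} (f ` A)" "strict_mono_on {..<card A} g"
    using ex_bij_betw_strict_mono_card[OF fin] unfolding card by blast
  have inv: "bij_betw (inv_into A f) (f ` A) A"
    using assms(2) by (simp add: bij_betw_inv_into inj_on_imp_bij_betw)
  have *: "f ((inv_into A f \<circ> g) i) = g i" if "i < card A" for i
    using g(1) that by (auto simp: bij_betw_def intro!: f_inv_into_f)
  show thesis
  proof (rule that[of "inv_into A f \<circ> g"])
    show "bij_betw (inv_into A f \<circ> g) {0..<card A} A"
      using bij_betw_trans[OF g(1) inv] by (simp add: atLeast0LessThan)
    show "f ((inv_into A f \<circ> g) i) < f ((inv_into A f \<circ> g) j)" if "i < j" "j < card A" for i j
      using that * strict_mono_onD[OF g(2), of i j] by auto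
  qed
qed

text \<open>Both notions depend only on the absolute differences of labels. This serves two
  relabelings: shifting the least label to 0 and reflecting all labels.\<close>

lemma radio_labeling_isometry:
  assumes "radio_labeling G \<phi>"
    and "\<And>u v. u \<in> verts G \<Longrightarrow> v \<in> verts G \<Longrightarrow>
      \<bar>int (\<psi> u) - int (\<psi> v)\<bar> = \<bar>int (\<phi> u) - int (\<phi> v)\<bar>"
  shows "radio_labeling G \<psi>" "label_span G \<psi> = label_span G \<phi>"
proof -
  show "radio_labeling G \<psi>"
    using assms unfolding radio_labeling_def by simp
  have "{nat \<bar>int (\<psi> u) - int (\<psi> v)\<bar> | u v. u \<in> verts G \<and> v \<in> verts G}
      = {nat \<bar>int (\<phi> u) - int (\<phi> v)\<bar> | u v. u \<in> verts G \<and> v \<in> verts G}"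
    using assms(2) by (intro Collect_cong) (metis (no_types, lifting))
  then show "label_span G \<psi> = label_span G \<phi>"
    unfolding label_span_def by simp
qed

section \<open>Distance in a connected graph\<close>

locale connected_graph = graph +
  assumes conn: "Digraph_Component.connected G"
begin

lemma gdist_le_length: "awalk u q v \<Longrightarrow> gdist G u v \<le> length q"
  unfolding gdist_def by (blast intro: Least_le)

text \<open>Connectedness refers to the symmetric closure; as the arcs are already symmetric, it
  yields directed walks, so the \<open>LEAST\<close> in \<open>gdist\<close> is attained.\<close>

lemma shortest_awalk:
  assumes "u \<in> verts G" "v \<in> verts G"
  obtains q where "awalk u q v" "length q = gdist G u v"
proof -
  have "strongly_connected G"
    using symmetric_connected_imp_strongly_connected[OF sym_arcs conn] .
  then have "u \<rightarrow>\<^sup>* v"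
    using assms by (auto simp: strongly_connected_def)
  then have "\<exists>n q. awalk u q v \<and> length q = n"
    by (auto simp: reachable_awalk)
  then have "\<exists>q. awalk u q v \<and> length q = gdist G u v"
    unfolding gdist_def by (rule LeastI_ex)
  then show thesis using that by blast
qed

lemma adj_sym: "u \<rightarrow>\<^bsub>G\<^esub> v \<Longrightarrow> v \<rightarrow>\<^bsub>G\<^esub> u"
  using sym_arcs by (auto simp: symmetric_def sym_def)

lemma gdist_triangle:
  assumes "u \<in> verts G" "v \<in> verts G" "w \<in> verts G"
  shows "gdist G u w \<le> gdist G u v + gdist G v w"
proof -
  obtain q r where "awalk u q v" "length q = gdist G u v" "awalk v r w" "length r = gdist G v w"
    using shortest_awalk assms by metis
  then show ?thesis
    using gdist_le_length[OF awalk_appendI, of u q v r w] by simp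
qed

lemma gdist_self: "u \<in> verts G \<Longrightarrow> gdist G u u = 0"
  using gdist_le_length[of u "[]" u] by (simp add: awalk_Nil_iff)

lemma gdist_eq_0:
  assumes "u \<in> verts G" "v \<in> verts G" "gdist G u v = 0"
  shows "u = v"
  using assms shortest_awalk[of u v] by (metis awalk_Nil_iff length_0_conv)

lemma gdist_adj: "u \<rightarrow>\<^bsub>G\<^esub> v \<Longrightarrow> gdist G u v \<le> 1"
proof -
  assume "u \<rightarrow>\<^bsub>G\<^esub> v"
  then obtain e where "arc e (u, v)" by (auto simp: arcs_ends_conv arc_def)
  then have "awalk u [e] v"
    by (auto simp: awalk_Cons_iff awalk_Nil_iff arc_def)
  then show ?thesis using gdist_le_length[of u "[e]" v] by simp
qed

lemma first_step:
  assumes "u \<in> verts G" "w \<in> verts G" "gdist G u w = Suc n"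
  obtains v where "u \<rightarrow>\<^bsub>G\<^esub> v" "v \<in> verts G" "gdist G v w \<le> n"
proof -
  obtain q where q: "awalk u q w" "length q = Suc n"
    using shortest_awalk assms by metis
  then obtain e r where [simp]: "q = e # r" by (cases q) auto
  have e: "e \<in> arcs G" "tail G e = u" and r: "awalk (head G e) r w"
    using q(1) by (auto simp: awalk_Cons_iff)
  show thesis
  proof (rule that)
    show "u \<rightarrow>\<^bsub>G\<^esub> head G e" using e by (auto simp: arcs_ends_conv)
    show "head G e \<in> verts G" using e by simp
    show "gdist G (head G e) w \<le> n" using gdist_le_length[OF r] q(2) by simp
  qed
qed

text \<open>Walks are not reversed as a whole. Induction on the distance moves \<open>u\<close> to a
  neighbour \<open>w\<close> nearer to \<open>v\<close>; only the single arc between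
  \<open>u\<close> and \<open>w\<close> is turned round.\<close>

lemma gdist_commute_le:
  assumes "u \<in> verts G" "v \<in> verts G"
  shows "gdist G v u \<le> gdist G u v"
  using assms
proof (induction "gdist G u v" arbitrary: u rule: less_induct)
  case less
  show ?case
  proof (cases "gdist G u v")
    case 0
    then have "u = v" using gdist_eq_0 less.prems by blast
    then show ?thesis by simp
  next
    case (Suc n)
    then obtain w where w: "u \<rightarrow>\<^bsub>G\<^esub> w" "w \<in> verts G" "gdist G w v \<le> n"
      using first_step less.prems by metis
    then have "gdist G v w \<le> n"
      using less.hyps[of w] less.prems Suc by simp
    moreover have "gdist G w u \<le> 1"
      using gdist_adj adj_sym w(1) by blast
    ultimately show ?thesis
      using gdist_triangle[of v w u] less.prems w(2) Suc by simp
  qed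
qed

lemma gdist_commute: "u \<in> verts G \<Longrightarrow> v \<in> verts G \<Longrightarrow> gdist G u v = gdist G v u"
  by (simp add: antisym gdist_commute_le)

section \<open>Diameter, distance to a set, and layers\<close>

lemma gdist_le_max_dist:
  assumes "S \<subseteq> verts G" "u \<in> S" "v \<in> S"
  shows "gdist G u v \<le> max_dist G S"
proof -
  have "finite S" using assms(1) finite_subset finite_verts by blast
  then have "finite ((\<lambda>(u, v). gdist G u v) ` (S \<times> S))" by simp
  moreover have "(\<lambda>(u, v). gdist G u v) ` (S \<times> S) = {gdist G u v | u v. u \<in> S \<and> v \<in> S}"
    by force
  ultimately show ?thesis
    unfolding max_dist_def using assms by (auto intro!: Max_ge)
qed

lemma gdist_le_diam: "u \<in> verts G \<Longrightarrow> v \<in> verts G \<Longrightarrow> gdist G u v \<le> diam G"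
  unfolding diam_def by (simp add: gdist_le_max_dist)

lemma dist_to_set_le:
  assumes "S \<subseteq> verts G" "w \<in> S"
  shows "dist_to_set G v S \<le> gdist G v w"
proof -
  have "finite {gdist G v w | w. w \<in> S}"
    using finite_subset[OF assms(1) finite_verts] by simp
  then show ?thesis
    unfolding dist_to_set_def using assms(2) by (auto intro: Min_le)
qed

lemma dist_to_set_attained:
  assumes "S \<subseteq> verts G" "S \<noteq> {}"
  obtains w where "w \<in> S" "gdist G v w = dist_to_set G v S"
proof -
  have "finite {gdist G v w | w. w \<in> S}"
    using finite_subset[OF assms(1) finite_verts] by simp
  then have "dist_to_set G v S \<in> {gdist G v w | w. w \<in> S}"
    unfolding dist_to_set_def using assms(2) by (intro Min_in) auto
  then show thesis using that by auto
qed

lemma dist_to_set_eq_0_iff: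
  assumes "S \<subseteq> verts G" "S \<noteq> {}" "v \<in> verts G"
  shows "dist_to_set G v S = 0 \<longleftrightarrow> v \<in> S"
proof
  assume "dist_to_set G v S = 0"
  then show "v \<in> S"
    using dist_to_set_attained[OF assms(1,2), of v] gdist_eq_0 assms by (metis subsetD)
next
  assume "v \<in> S"
  then show "dist_to_set G v S = 0"
    using dist_to_set_le[OF assms(1), of v v] gdist_self assms(3) by simp
qed

lemma dist_to_set_adj:
  assumes "S \<subseteq> verts G" "S \<noteq> {}" "u \<rightarrow>\<^bsub>G\<^esub> v"
  shows "dist_to_set G u S \<le> Suc (dist_to_set G v S)"
proof -
  obtain w where w: "w \<in> S" "gdist G v w = dist_to_set G v S"
    using dist_to_set_attained assms(1,2) by metis
  have "dist_to_set G u S \<le> gdist G u w"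
    using dist_to_set_le assms(1) w(1) by blast
  also have "\<dots> \<le> gdist G u v + gdist G v w"
    using assms w(1) by (intro gdist_triangle) auto
  finally show ?thesis
    using gdist_adj[OF assms(3)] w(2) by simp
qed

text \<open>The first step of a shortest walk to a nearest element of \<open>S\<close> gets to
  distance at most \<open>n\<close>; adjacent vertices differ by at most one, so it is exactly
  \<open>n\<close>. The arc is returned pointing towards \<open>v\<close>, as \<open>nbhd\<close>
  wants it.\<close>

lemma dist_to_set_step:
  assumes "S \<subseteq> verts G" "S \<noteq> {}" "v \<in> verts G" "dist_to_set G v S = Suc n"
  obtains u where "u \<rightarrow>\<^bsub>G\<^esub> v" "u \<in> verts G" "dist_to_set G u S = n"
proof -
  obtain w where w: "w \<in> S" "gdist G v w = Suc n"
    using dist_to_set_attained assms by metis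
  then obtain u where u: "v \<rightarrow>\<^bsub>G\<^esub> u" "u \<in> verts G" "gdist G u w \<le> n"
    using first_step assms by (metis subsetD)
  have "dist_to_set G u S \<le> n"
    using dist_to_set_le[OF assms(1) w(1), of u] u(3) by simp
  moreover have "Suc n \<le> Suc (dist_to_set G u S)"
    using dist_to_set_adj[OF assms(1,2) u(1)] assms(4) by simp
  ultimately show thesis
    using that[OF adj_sym[OF u(1)] u(2)] by simp
qed

text \<open>A layer removes all earlier ones, hence strong induction. A neighbour of distance
  \<open>n\<close> has distance at most \<open>n + 1\<close>, and removal leaves exactly
  \<open>n + 1\<close>; conversely \<open>dist_to_set_step\<close> supplies a predecessor in layer
  \<open>n\<close>.\<close>

lemma layer_eq:
  assumes "S \<subseteq> verts G" "S \<noteq> {}"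
  shows "layer G S i = {v \<in> verts G. dist_to_set G v S = i}"
proof (induction i rule: less_induct)
  case (less i)
  show ?case
  proof (cases i)
    case 0
    then show ?thesis using assms dist_to_set_eq_0_iff by auto
  next
    case (Suc n)
    have IH: "layer G S j = {v \<in> verts G. dist_to_set G v S = j}" if "j \<le> n" for j
      using less Suc that by simp
    have "layer G S (Suc n) =
        nbhd G {v \<in> verts G. dist_to_set G v S = n} - {v \<in> verts G. dist_to_set G v S \<le> n}"
      using IH by auto
    also have "\<dots> = {v \<in> verts G. dist_to_set G v S = Suc n}"
    proof (intro equalityI subsetI)
      fix v assume "v \<in> nbhd G {v \<in> verts G. dist_to_set G v S = n}
          - {v \<in> verts G. dist_to_set G v S \<le> n}"
      then obtain u where "v \<in> verts G" "u \<rightarrow>\<^bsub>G\<^esub> v" "dist_to_set G u S = n" "dist_to_set G v S > n"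
        by (auto simp: nbhd_def)
      then show "v \<in> {v \<in> verts G. dist_to_set G v S = Suc n}"
        using dist_to_set_adj[OF assms adj_sym, of u v] by simp
    next
      fix v assume "v \<in> {v \<in> verts G. dist_to_set G v S = Suc n}"
      then show "v \<in> nbhd G {v \<in> verts G. dist_to_set G v S = n}
          - {v \<in> verts G. dist_to_set G v S \<le> n}"
        using dist_to_set_step[OF assms] by (auto simp: nbhd_def) metis
    qed
    finally show ?thesis using Suc by simp
  qed
qed

lemma sum_layers:
  assumes "S \<subseteq> verts G" "S \<noteq> {}"
  shows "(\<Sum>i=0..Max {i. layer G S i \<noteq> {}}. int (card (layer G S i)) * int i)
    = (\<Sum>v\<in>verts G. int (dist_to_set G v S))"
proof -
  let ?l = "\<lambda>v. dist_to_set G v S"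
  \<comment> \<open>As an image of the finite vertex set this index set is finite, so its
    \<open>Max\<close> bounds every distance and the vertices can be grouped by distance.\<close>
  have "{i. layer G S i \<noteq> {}} = ?l ` verts G"
    using layer_eq[OF assms] by auto
  then have "?l ` verts G \<subseteq> {0..Max {i. layer G S i \<noteq> {}}}"
    by auto
  then have "(\<Sum>v\<in>verts G. int (?l v))
      = (\<Sum>i=0..Max {i. layer G S i \<noteq> {}}. \<Sum>v | v \<in> verts G \<and> ?l v = i. int (?l v))"
    by (rule sum.group[OF finite_verts finite_atLeastAtMost, symmetric])
  also have "\<dots> = (\<Sum>i=0..Max {i. layer G S i \<noteq> {}}. int (card (layer G S i)) * int i)"
    using layer_eq[OF assms] by (intro sum.cong) auto
  finally show ?thesis by simp
qed

text \<open>Go from \<open>u\<close> to a nearest point \<open>a\<close> of \<open>S\<close>, across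
  \<open>S\<close> to a point \<open>b\<close> nearest to \<open>v\<close>, and on to
  \<open>v\<close>. This is the source of the lower bound on consecutive label gaps.\<close>

lemma gdist_through_set:
  assumes "S \<subseteq> verts G" "S \<noteq> {}" "u \<in> verts G" "v \<in> verts G"
  shows "gdist G u v \<le> dist_to_set G u S + dist_to_set G v S + max_dist G S"
proof -
  obtain a where a: "a \<in> S" "gdist G u a = dist_to_set G u S"
    using dist_to_set_attained assms(1,2) by metis
  obtain b where b: "b \<in> S" "gdist G v b = dist_to_set G v S"
    using dist_to_set_attained assms(1,2) by metis
  have "gdist G u v \<le> gdist G u a + gdist G a v"
    using a assms by (intro gdist_triangle) auto
  moreover have "gdist G a v \<le> gdist G a b + gdist G b v"
    using a b assms by (intro gdist_triangle) auto
  moreover have "gdist G b v = gdist G v b"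
    using b assms by (intro gdist_commute) auto
  moreover have "gdist G a b \<le> max_dist G S"
    using gdist_le_max_dist assms(1) a(1) b(1) by blast
  ultimately show ?thesis using a b by simp
qed

section \<open>Radio labelings and optimal orderings\<close>

lemma radio_labeling_inj: "radio_labeling G \<phi> \<Longrightarrow> inj_on \<phi> (verts G)"
proof (rule inj_onI, rule ccontr)
  fix u v assume *: "radio_labeling G \<phi>" "u \<in> verts G" "v \<in> verts G" "\<phi> u = \<phi> v" "u \<noteq> v"
  \<comment> \<open>Equal labels contribute nothing, so the distance alone would have to exceed the
    diameter.\<close>
  then have "int (gdist G u v) \<ge> int (diam G) + 1"
    unfolding radio_labeling_def by fastforce
  then show False using gdist_le_diam[OF *(2,3)] by simp
qed

text \<open>Any injective numbering stretched by \<open>diam G + 1\<close> meets the condition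
  through the labels alone. This makes the \<open>LEAST\<close> in \<open>radio_number\<close> an
  attained minimum.\<close>

lemma radio_labeling_exists: "\<exists>\<phi>. radio_labeling G \<phi>"
proof -
  obtain f :: "'a \<Rightarrow> nat" where f: "inj_on f (verts G)"
    using finite_imp_inj_to_nat_seg[OF finite_verts] by blast
  show ?thesis
    unfolding radio_labeling_def
  proof (intro exI[of _ "\<lambda>v. (diam G + 1) * f v"] ballI impI)
    fix u v assume "u \<in> verts G" "v \<in> verts G" "u \<noteq> v"
    then have "f u \<noteq> f v" using f by (auto dest: inj_onD)
    then have "1 \<le> \<bar>int (f u) - int (f v)\<bar>" by linarith
    then have "(int (diam G) + 1) * 1 \<le> (int (diam G) + 1) * \<bar>int (f u) - int (f v)\<bar>"
      by (intro mult_left_mono) auto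
    also have "\<dots> = \<bar>(int (diam G) + 1) * (int (f u) - int (f v))\<bar>"
      by (simp add: abs_mult)
    finally show "int (diam G) + 1 \<le> int (gdist G u v)
        + \<bar>int ((diam G + 1) * f u) - int ((diam G + 1) * f v)\<bar>"
      by (simp add: algebra_simps)
  qed
qed

lemma label_span_eq:
  assumes "a \<in> verts G" "b \<in> verts G" "\<And>v. v \<in> verts G \<Longrightarrow> \<phi> a \<le> \<phi> v \<and> \<phi> v \<le> \<phi> b"
  shows "label_span G \<phi> = \<phi> b - \<phi> a"
  unfolding label_span_def
proof (rule Max_eqI)
  have "{nat \<bar>int (\<phi> u) - int (\<phi> v)\<bar> | u v. u \<in> verts G \<and> v \<in> verts G}
      = (\<lambda>(u, v). nat \<bar>int (\<phi> u) - int (\<phi> v)\<bar>) ` (verts G \<times> verts G)"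
    by force
  then show "finite {nat \<bar>int (\<phi> u) - int (\<phi> v)\<bar> | u v. u \<in> verts G \<and> v \<in> verts G}"
    by simp
next
  fix y assume "y \<in> {nat \<bar>int (\<phi> u) - int (\<phi> v)\<bar> | u v. u \<in> verts G \<and> v \<in> verts G}"
  then obtain u v where y: "y = nat \<bar>int (\<phi> u) - int (\<phi> v)\<bar>" "u \<in> verts G" "v \<in> verts G"
    by blast
  show "y \<le> \<phi> b - \<phi> a"
    using assms(3)[OF y(2)] assms(3)[OF y(3)] y(1) by linarith
next
  have "\<phi> b - \<phi> a = nat \<bar>int (\<phi> b) - int (\<phi> a)\<bar>"
    using assms(3)[OF assms(1)] by linarith
  then show "\<phi> b - \<phi> a \<in> {nat \<bar>int (\<phi> u) - int (\<phi> v)\<bar> | u v. u \<in> verts G \<and> v \<in> verts G}"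
    using assms(1,2) by blast
qed

lemma verts_card_pos: "card (verts G) > 0"
  using conn by (simp add: card_gt_0_iff connected_def strongly_connected_def)

lemma optimal_ordering_exists: "\<exists>\<phi> x. optimal_ordering G \<phi> x"
proof -
  let ?m = "card (verts G) - 1"
  have "\<exists>s \<psi>. radio_labeling G \<psi> \<and> label_span G \<psi> = s"
    using radio_labeling_exists by blast
  then have "\<exists>\<psi>. radio_labeling G \<psi> \<and> label_span G \<psi> = radio_number G"
    unfolding radio_number_def by (rule LeastI_ex)
  then obtain \<psi> where \<psi>: "radio_labeling G \<psi>" "label_span G \<psi> = radio_number G"
    by blast
  obtain x where x: "bij_betw x {0..<card (verts G)} (verts G)"
      "\<And>i j. i < j \<Longrightarrow> j < card (verts G) \<Longrightarrow> \<psi> (x i) < \<psi> (x j)"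
    using ordering_by_labels[OF finite_verts radio_labeling_inj[OF \<psi>(1)]] by metis
  have "{0..<card (verts G)} = {0..?m}"
    using verts_card_pos by auto
  with x(1) have bij: "bij_betw x {0..?m} (verts G)" by simp
  have ends: "x 0 \<in> verts G" "x ?m \<in> verts G"
    using bij by (auto dest: bij_betwE)
  have range: "\<psi> (x 0) \<le> \<psi> v \<and> \<psi> v \<le> \<psi> (x ?m)" if "v \<in> verts G" for v
  proof -
    have "v \<in> x ` {0..?m}"
      using that bij_betw_imp_surj_on[OF bij] by blast
    then obtain i where "i \<le> ?m" "v = x i" by auto
    then show ?thesis
      using x(2)[of 0 i] x(2)[of i ?m] verts_card_pos
      by (cases "i = 0"; cases "i = ?m") (auto intro: less_imp_le)
  qed
  \<comment> \<open>A labeling of minimum span need not use the label 0. As \<open>x 0\<close> has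
    the least label, this truncated subtraction is exact on the vertices.\<close>
  let ?\<phi> = "\<lambda>v. \<psi> v - \<psi> (x 0)"
  have iso: "\<bar>int (?\<phi> u) - int (?\<phi> v)\<bar> = \<bar>int (\<psi> u) - int (\<psi> v)\<bar>"
    if "u \<in> verts G" "v \<in> verts G" for u v
    using range[OF that(1)] range[OF that(2)] by simp
  have "\<psi> (x i) - \<psi> (x 0) < \<psi> (x (Suc i)) - \<psi> (x 0)" if "i < ?m" for i
  proof -
    have "x i \<in> verts G" using that bij by (auto dest: bij_betwE)
    moreover have "Suc i < card (verts G)" using that by simp
    ultimately show ?thesis
      using range[of "x i"] x(2)[of i "Suc i"] by linarith
  qed
  moreover have "\<psi> (x ?m) - \<psi> (x 0) = label_span G ?\<phi>"
    using label_span_eq[OF ends range] radio_labeling_isometry(2)[OF \<psi>(1) iso] by simp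
  ultimately have "optimal_ordering G ?\<phi> x"
    unfolding optimal_ordering_def
    using radio_labeling_isometry[OF \<psi>(1) iso] \<psi>(2) bij by simp
  then show ?thesis by blast
qed

text \<open>Reflecting the labels in the interval from 0 to the span exchanges first and last
  vertex. It is needed when \<open>L0\<close> is a singleton and its vertex comes last.\<close>

lemma optimal_ordering_reverse:
  assumes "optimal_ordering G \<phi> x"
  defines "m \<equiv> card (verts G) - 1"
  shows "optimal_ordering G (\<lambda>v. \<phi> (x m) - \<phi> v) (\<lambda>i. x (m - i))"
proof -
  have radio: "radio_labeling G \<phi>" and bij: "bij_betw x {0..m} (verts G)"
    and zero: "\<phi> (x 0) = 0" and steps: "\<forall>i<m. \<phi> (x i) < \<phi> (x (Suc i))"
    and last: "\<phi> (x m) = label_span G \<phi>" "label_span G \<phi> = radio_number G"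
    using assms(1) by (auto simp: optimal_ordering_def m_def)
  have mono: "\<phi> (x i) \<le> \<phi> (x j)" if "i \<le> j" "j \<le> m" for i j
    using strict_steps_mono[of m "\<lambda>i. \<phi> (x i)"] steps that by simp
  have le: "\<phi> v \<le> \<phi> (x m)" if "v \<in> verts G" for v
    using that mono unfolding bij_betw_imp_surj_on[OF bij, symmetric] by auto
  let ?\<phi> = "\<lambda>v. \<phi> (x m) - \<phi> v"
  have iso: "\<bar>int (?\<phi> u) - int (?\<phi> v)\<bar> = \<bar>int (\<phi> u) - int (\<phi> v)\<bar>"
    if "u \<in> verts G" "v \<in> verts G" for u v
    using le[OF that(1)] le[OF that(2)] by simp
  have "bij_betw (\<lambda>i. m - i) {0..m} {0..m}"
    by (rule bij_betw_byWitness[where f' = "\<lambda>i. m - i"]) auto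
  from bij_betw_trans[OF this bij] have "bij_betw (\<lambda>i. x (m - i)) {0..m} (verts G)"
    by (simp add: comp_def)
  \<comment> \<open>Strictness survives natural-number subtraction because no label exceeds that of
    \<open>x m\<close>.\<close>
  moreover have "\<phi> (x m) - \<phi> (x (m - i)) < \<phi> (x m) - \<phi> (x (m - Suc i))" if "i < m" for i
  proof -
    have "\<phi> (x (m - Suc i)) < \<phi> (x (Suc (m - Suc i)))"
      using steps that by simp
    moreover have "\<phi> (x (Suc (m - Suc i))) \<le> \<phi> (x m)"
      using that by (intro mono) auto
    ultimately show ?thesis using that by (simp add: Suc_diff_Suc)
  qed
  ultimately show ?thesis
    unfolding optimal_ordering_def m_def[symmetric]
    using radio_labeling_isometry[OF radio iso] zero last by simp
qed

section \<open>The span formula and its equality case\<close>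

lemma optimal_ordering_span:
  assumes "optimal_ordering G \<phi> x" "S \<subseteq> verts G" "S \<noteq> {}"
  defines "m \<equiv> card (verts G) - 1" and "l \<equiv> \<lambda>i. dist_to_set G (x i) S"
  shows "int (radio_number G) =
    int m * c - 2 * (\<Sum>v\<in>verts G. int (dist_to_set G v S)) + int (l 0) + int (l m)
      + (\<Sum>i<m. int (\<phi> (x (Suc i))) - int (\<phi> (x i)) - (c - int (l i) - int (l (Suc i))))"
proof -
  have "bij_betw x {0..m} (verts G)" "\<phi> (x 0) = 0" "\<phi> (x m) = radio_number G"
    using assms(1) by (auto simp: optimal_ordering_def m_def)
  \<comment> \<open>The labels run from 0 to the radio number, and the sum along the ordering is
    reindexed to a sum over all vertices.\<close>
  then show ?thesis
    using sum_slack[of "\<lambda>i. int (\<phi> (x i))" m c "\<lambda>i. int (l i)"]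
      sum.reindex_bij_betw[of x "{0..m}" "verts G" "\<lambda>v. int (dist_to_set G v S)"]
    by (simp add: l_def)
qed

text \<open>Two distinct vertices cannot both be the only element of a singleton \<open>S\<close>,
  so one of them has positive distance.\<close>

lemma dist_to_set_ends:
  assumes "S \<subseteq> verts G" "S \<noteq> {}" "u \<in> verts G" "v \<in> verts G" "u \<noteq> v"
  shows "(if card S = 1 then 1 else 0) \<le> dist_to_set G u S + dist_to_set G v S"
  using assms dist_to_set_eq_0_iff[OF assms(1,2)]
  by (auto simp: card_1_singleton_iff Suc_le_eq)

text \<open>Comparing the assumed value with \<open>optimal_ordering_span\<close> leaves nonnegative
  quantities of total zero. Any optimal ordering qualifies, so the lemma applies before and after a
  possible reversal.\<close>

lemma optimal_ordering_tight:
  fixes S :: "'a set"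
  assumes opt: "optimal_ordering G \<phi> x" and S: "S \<subseteq> verts G" "S \<noteq> {}"
    and two: "card (verts G) \<ge> 2"
  defines "m \<equiv> card (verts G) - 1" and "l \<equiv> \<lambda>i. dist_to_set G (x i) S"
    and "\<delta> \<equiv> if card S = 1 then 1 else (0::nat)" and "k \<equiv> max_dist G S"
  assumes rn: "int (radio_number G) = int m * (int (diam G) - int k + 1) + int \<delta>
    - 2 * (\<Sum>v\<in>verts G. int (dist_to_set G v S))"
  shows "l 0 + l m = \<delta>"
    and "\<And>i. i < m \<Longrightarrow> gdist G (x i) (x (Suc i)) = l i + l (Suc i) + k"
    and "\<And>i. i < m \<Longrightarrow> int (\<phi> (x (Suc i))) =
      int (\<phi> (x i)) + int (diam G) + 1 - int (l i) - int (l (Suc i)) - int k"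
proof -
  have radio: "radio_labeling G \<phi>" and bij: "bij_betw x {0..m} (verts G)"
    and steps: "\<forall>i<m. \<phi> (x i) < \<phi> (x (Suc i))"
    using opt by (auto simp: optimal_ordering_def m_def)
  have in_verts: "x i \<in> verts G" if "i \<le> m" for i
    using that bij by (auto dest: bij_betwE)
  let ?c = "int (diam G) - int k + 1"
  let ?e = "\<lambda>i. int (\<phi> (x (Suc i))) - int (\<phi> (x i)) - (?c - int (l i) - int (l (Suc i)))"
  have radio_step: "int (\<phi> (x (Suc i))) - int (\<phi> (x i)) \<ge> int (diam G) + 1 - int (gdist G (x i) (x (Suc i)))"
    and gdist_step: "gdist G (x i) (x (Suc i)) \<le> l i + l (Suc i) + k" if "i < m" for i
  proof -
    have v: "x i \<in> verts G" "x (Suc i) \<in> verts G" and lt: "\<phi> (x i) < \<phi> (x (Suc i))"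
      using that in_verts steps by auto
    then have "x i \<noteq> x (Suc i)" by auto
    then have "int (diam G) + 1 \<le> int (gdist G (x i) (x (Suc i)))
        + \<bar>int (\<phi> (x i)) - int (\<phi> (x (Suc i)))\<bar>"
      using radio v unfolding radio_labeling_def by blast
    then show "int (\<phi> (x (Suc i))) - int (\<phi> (x i)) \<ge> int (diam G) + 1 - int (gdist G (x i) (x (Suc i)))"
      using lt by linarith
    show "gdist G (x i) (x (Suc i)) \<le> l i + l (Suc i) + k"
      unfolding l_def k_def using gdist_through_set[OF S v] .
  qed
  have e_nonneg: "0 \<le> ?e i" if "i < m" for i
    using radio_step[OF that] gdist_step[OF that] by linarith
  \<comment> \<open>With at least two vertices the first and the last are distinct, as
    \<open>dist_to_set_ends\<close> requires.\<close>
  have "m > 0" using two by (simp add: m_def)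
  then have "x 0 \<noteq> x m"
    using bij by (auto simp: bij_betw_def dest: inj_onD)
  then have ends: "\<delta> \<le> l 0 + l m"
    unfolding \<delta>_def l_def using S in_verts by (intro dist_to_set_ends) auto
  have sum_nonneg: "0 \<le> (\<Sum>i<m. ?e i)"
    using e_nonneg by (intro sum_nonneg) auto
  have total: "int (l 0) + int (l m) + (\<Sum>i<m. ?e i) = int \<delta>"
    using optimal_ordering_span[OF opt S, of ?c] rn unfolding m_def l_def by linarith
  show "l 0 + l m = \<delta>"
    using ends sum_nonneg total by linarith
  have "(\<Sum>i<m. ?e i) = 0"
    using ends sum_nonneg total by linarith
  then have e_zero: "?e i = 0" if "i < m" for i
    using sum_nonneg_eq_0_iff[of "{..<m}" ?e] e_nonneg that by auto
  \<comment> \<open>\<open>?e i\<close> is the slack of the radio condition plus the slack of the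
    path through \<open>S\<close>. Both are nonnegative, so both vanish; the second gives this
    equation.\<close>
  show "gdist G (x i) (x (Suc i)) = l i + l (Suc i) + k" if "i < m" for i
    using radio_step[OF that] gdist_step[OF that] e_zero[OF that] by linarith
  show "int (\<phi> (x (Suc i))) =
      int (\<phi> (x i)) + int (diam G) + 1 - int (l i) - int (l (Suc i)) - int k" if "i < m" for i
    using e_zero[OF that] by linarith
qed

end

section \<open>The equivalence for the radio number\<close>

theorem theorem2:
  fixes G :: "('a, 'b) pre_digraph" and L0 :: "'a set" and p d k h \<delta> :: nat
  assumes "graph G" and "Digraph_Component.connected G"
    and "p = card (verts G)" and "p \<ge> 2"
    and "d = diam G"
    and "L0 \<subseteq> verts G" and "L0 \<noteq> {}"
    and "k = max_dist G L0"
    and "h = Max {i. layer G L0 i \<noteq> {}}"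
    and "\<delta> = (if card L0 = 1 then 1 else 0)"
  shows "int (radio_number G) =
           (int p - 1) * (int d - int k + 1) + int \<delta>
             - 2 * (\<Sum>i=0..h. int (card (layer G L0 i)) * int i)
     \<longleftrightarrow>
     (\<exists>(\<phi> :: 'a \<Rightarrow> nat) (x :: nat \<Rightarrow> 'a).
        radio_labeling G \<phi> \<and> bij_betw x {0..p - 1} (verts G) \<and>
        \<phi> (x 0) = 0 \<and> (\<forall>i\<in>{0..p - 2}. \<phi> (x i) < \<phi> (x (i + 1))) \<and>
        \<phi> (x (p - 1)) = label_span G \<phi> \<and> label_span G \<phi> = radio_number G \<and>
        (\<forall>i\<in>{0..p - 2}. gdist G (x i) (x (i + 1))
            = dist_to_set G (x i) L0 + dist_to_set G (x (i + 1)) L0 + k) \<and>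
        (card L0 \<ge> 2 \<longrightarrow> x 0 \<in> L0 \<and> x (p - 1) \<in> L0) \<and>
        (card L0 = 1 \<longrightarrow> x 0 \<in> L0 \<and> x (p - 1) \<in> layer G L0 1) \<and>
        (\<forall>i\<in>{0..p - 2}. int (\<phi> (x (i + 1))) =
            int (\<phi> (x i)) + int d + 1 - int (dist_to_set G (x i) L0)
              - int (dist_to_set G (x (i + 1)) L0) - int k))"
proof -
  interpret graph G by fact
  interpret connected_graph G by unfold_locales fact
  let ?m = "card (verts G) - 1"
  let ?l = "\<lambda>v. dist_to_set G v L0"
  have L0: "L0 \<subseteq> verts G" "L0 \<noteq> {}" by fact+
  have two: "card (verts G) \<ge> 2" using assms(3,4) by simp
  \<comment> \<open>Since \<open>p\<close> is at least 2, the truncated \<open>p - 2\<close> is the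
    true last step index.\<close>
  have steps: "{0..p - 2} = {..<?m}" "p - 1 = ?m" using assms(3,4) by auto
  have intp: "int p - 1 = int ?m" using assms(3,4) by simp
  have sum: "(\<Sum>i=0..h. int (card (layer G L0 i)) * int i) = (\<Sum>v\<in>verts G. int (?l v))"
    using sum_layers[OF L0] assms(9) by simp
  have card_L0: "card L0 = 1 \<or> card L0 \<ge> 2"
    using L0 finite_subset[OF L0(1) finite_verts] card_gt_0_iff[of L0] by linarith
  have l0: "v \<in> verts G \<Longrightarrow> ?l v = 0 \<longleftrightarrow> v \<in> L0" for v
    using dist_to_set_eq_0_iff[OF L0] .
  have l1: "v \<in> layer G L0 1 \<longleftrightarrow> v \<in> verts G \<and> ?l v = 1" for v
    using layer_eq[OF L0, of 1] by auto
  show ?thesis (is "?rn \<longleftrightarrow> ?R")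
  proof -
    \<comment> \<open>\<open>optimal_ordering\<close> gathers all requirements other than the
      distance equation, the end conditions and the label recursion.\<close>
    have R: "?R \<longleftrightarrow> (\<exists>\<phi> x. optimal_ordering G \<phi> x \<and>
        (\<forall>i<?m. gdist G (x i) (x (Suc i)) = ?l (x i) + ?l (x (Suc i)) + k) \<and>
        (card L0 \<ge> 2 \<longrightarrow> x 0 \<in> L0 \<and> x ?m \<in> L0) \<and>
        (card L0 = 1 \<longrightarrow> x 0 \<in> L0 \<and> x ?m \<in> layer G L0 1) \<and>
        (\<forall>i<?m. int (\<phi> (x (Suc i))) =
          int (\<phi> (x i)) + int d + 1 - int (?l (x i)) - int (?l (x (Suc i))) - int k))"
      unfolding steps optimal_ordering_def
      by (simp only: Ball_def lessThan_iff Suc_eq_plus1 conj_assoc)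
    show ?thesis
    proof
      assume ?rn
      then have rn: "int (radio_number G) =
          int ?m * (int (diam G) - int (max_dist G L0) + 1)
            + int (if card L0 = 1 then 1 else (0::nat)) - 2 * (\<Sum>v\<in>verts G. int (?l v))"
        unfolding sum intp assms(5,8,10) by simp
      \<comment> \<open>The end distances add up to at most 1, so one end lies in \<open>L0\<close>.
        If it is the last one, the reversed ordering is taken instead.\<close>
      obtain \<phi> x where opt: "optimal_ordering G \<phi> x"
          and first: "x 0 \<in> L0"
      proof -
        obtain \<phi> x where opt: "optimal_ordering G \<phi> x"
          using optimal_ordering_exists by blast
        have ends: "x 0 \<in> verts G" "x ?m \<in> verts G"
          using opt by (auto simp: optimal_ordering_def dest: bij_betwE)
        have "?l (x 0) = 0 \<or> ?l (x ?m) = 0"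
          using optimal_ordering_tight(1)[OF opt L0 two rn] by (auto simp: add_is_1 split: if_splits)
        then show thesis
          using that[OF opt] that[OF optimal_ordering_reverse[OF opt]] l0 ends by auto
      qed
      note tight = optimal_ordering_tight[OF opt L0 two rn]
      have ends: "x 0 \<in> verts G" "x ?m \<in> verts G"
        using opt by (auto simp: optimal_ordering_def dest: bij_betwE)
      \<comment> \<open>With the first end in \<open>L0\<close>, the last carries all of
        \<open>\<delta>\<close>: it lies in layer 1 for a singleton and in \<open>L0\<close>
        otherwise.\<close>
      have last: "?l (x ?m) = (if card L0 = 1 then 1 else 0)"
        using tight(1) l0[OF ends(1)] first by simp
      show ?R
        unfolding R
      proof (intro exI conjI)
        show "optimal_ordering G \<phi> x" by (fact opt)
      qed (use first last tight(2,3) l0[OF ends(2)] l1 ends assms(5,8) in auto)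
    next
      assume ?R
      then obtain \<phi> x where opt: "optimal_ordering G \<phi> x"
        and ends: "card L0 \<ge> 2 \<longrightarrow> x 0 \<in> L0 \<and> x ?m \<in> L0"
          "card L0 = 1 \<longrightarrow> x 0 \<in> L0 \<and> x ?m \<in> layer G L0 1"
        and c: "\<forall>i<?m. int (\<phi> (x (Suc i))) = int (\<phi> (x i)) + int d + 1 - int (?l (x i))
                - int (?l (x (Suc i))) - int k"
        unfolding R by blast
      \<comment> \<open>For the converse, the end conditions fix the end term of the span formula
        and the label recursion makes every slack zero, leaving the claimed value.\<close>
      have "?l (x 0) + ?l (x ?m) = \<delta>"
        using ends card_L0 l0 l1 L0(1) assms(10) by auto
      moreover have "(\<Sum>i<?m. int (\<phi> (x (Suc i))) - int (\<phi> (x i))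
          - ((int d - int k + 1) - int (?l (x i)) - int (?l (x (Suc i))))) = 0"
        using c by (intro sum.neutral) auto
      ultimately show ?rn
        using optimal_ordering_span[OF opt L0, of "int d - int k + 1"]
        unfolding sum intp by linarith
    qed
  qed
qed

end
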